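(* Let $n\geq 1$ and let $K_n$ be the complete graph on $n$ vertices. Then $K_n$ is equitable list point $k$-arborable for every integer $k\geq \lceil n/2\rceil$, and moreover $\rho_l^=(K_n)=\lceil n/2\rceil$.
   Context: All graphs are finite, simple and undirected. A $k$-list assignment of a graph $G$ assigns to each vertex $v$ a set (list) $L(v)$ of $k$ colors. A graph $G$ is list point $k$-arborable if for every $k$-list assignment $L$ one can choose a color $c(v)\in L(v)$ for each vertex $v$ such that each color class induces an acyclic subgraph (a forest) of $G$. A graph $G$ is equitable list point $k$-arborable if for every $k$-list assignment $L$ one can choose $c(v)\in L(v)$ for each vertex $v$ such that each color class induces an acyclic subgraph of $G$ and each color appears on at most $\lceil |V(G)|/k\rceil$ vertices of $G$. The equitable list point arboricity $\rho_l^=(G)$ is the minimum integer $k$ such that $G$ is equitable list point $k$-arborable. *)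

theory Defs
  imports Complex_Main "Graph_Theory.Graph_Theory"
begin

text \<open>
  Finite simple undirected graphs are the symmetric digraphs of the locale \<^locale>\<open>graph\<close>, where
  each edge is a pair of opposite arcs. The library predicate \<^const>\<open>forest\<close> is not usable
  for them: traversing a single edge forth and back is a \<^const>\<open>pre_digraph.cycle\<close> of length 2.
  The cycles of the undirected graph are exactly those of length at least 3.
\<close>

definition acyclic_graph :: "('a, 'b) pre_digraph \<Rightarrow> bool" where
  "acyclic_graph G \<longleftrightarrow> \<not> (\<exists>p. pre_digraph.cycle G p \<and> 3 \<le> length p)"

text \<open>
  Colors are natural numbers. Finiteness of the lists is explicit because \<^const>\<open>card\<close> is \<open>0\<close>
  on infinite sets.
\<close>

definition list_assignment :: "('a, 'b) pre_digraph \<Rightarrow> nat \<Rightarrow> ('a \<Rightarrow> nat set) \<Rightarrow> bool" where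
  "list_assignment G k L \<longleftrightarrow> (\<forall>v \<in> verts G. finite (L v) \<and> card (L v) = k)"

definition color_class :: "('a, 'b) pre_digraph \<Rightarrow> ('a \<Rightarrow> nat) \<Rightarrow> nat \<Rightarrow> 'a set" where
  "color_class G c x = {v \<in> verts G. c v = x}"

definition equitable_list_point_arborable :: "('a, 'b) pre_digraph \<Rightarrow> nat \<Rightarrow> bool" where
  "equitable_list_point_arborable G k \<longleftrightarrow>
    (\<forall>L. list_assignment G k L \<longrightarrow>
      (\<exists>c. (\<forall>v \<in> verts G. c v \<in> L v) \<and>
           (\<forall>x. acyclic_graph (G \<restriction> color_class G c x)) \<and>
           (\<forall>x. int (card (color_class G c x)) \<le> \<lceil>real (card (verts G)) / real k\<rceil>)))"

definition equitable_list_point_arboricity :: "('a, 'b) pre_digraph \<Rightarrow> nat" where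
  "equitable_list_point_arboricity G = (LEAST k. equitable_list_point_arborable G k)"

end

theory Submission
  imports Defs
begin

text \<open>
  In a complete graph a vertex set induces a forest iff it has at most two vertices. Given lists of
  size \<open>k\<close> with \<open>2 k \<ge> n\<close>, put \<open>m = \<lceil>n / k\<rceil> \<le> 2\<close> and color greedily, using each color at most
  \<open>m\<close> times: at each step fewer than \<open>n \<le> m k\<close> vertices are colored, so fewer than \<open>k\<close>
  colors are exhausted and some color of the current list is free. Conversely, if all lists are the
  same \<open>k\<close>-set, then \<open>k\<close> classes of size at most two cover the \<open>n\<close> vertices, so \<open>n \<le> 2 k\<close>.
\<close>

lemma ex_list_coloring_bounded_classes:
  fixes L :: "'a \<Rightarrow> 'c set"
  assumes "finite V" and "card V \<le> m * k"
    and "\<And>v. v \<in> V \<Longrightarrow> finite (L v) \<and> card (L v) = k"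
  shows "\<exists>c. (\<forall>v\<in>V. c v \<in> L v) \<and> (\<forall>x. card {v \<in> V. c v = x} \<le> m)"
  using assms
proof (induction V rule: finite_induct)
  case empty
  then show ?case by simp
next
  case (insert v F)
  then obtain c where c: "\<forall>w\<in>F. c w \<in> L w" "\<forall>x. card {w \<in> F. c w = x} \<le> m"
    by auto
  \<comment> \<open>\<open>B\<close> collects the exhausted colors of the list of \<open>v\<close>.
    Their classes in \<open>F\<close> are pairwise disjoint and have exactly \<open>m\<close>
    vertices each, so \<open>m * card B\<close> counts colored vertices; this is below
    \<open>m * k\<close> because \<open>v\<close> itself is still uncolored.\<close>
  define B where "B = {x \<in> L v. card {w \<in> F. c w = x} = m}"
  have fin: "finite (L v)" "card (L v) = k"
    using insert.prems by auto
  then have finB: "finite B"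
    by (simp add: B_def)
  have "m * card B = (\<Sum>x\<in>B. card {w \<in> F. c w = x})"
    by (simp add: B_def)
  also have "\<dots> = card (\<Union>x\<in>B. {w \<in> F. c w = x})"
    using finB insert.hyps by (subst card_UN_disjoint) auto
  also have "\<dots> \<le> card F"
    using insert.hyps by (intro card_mono) auto
  also have "\<dots> < m * k"
    using insert.prems insert.hyps by simp
  finally have "card B < card (L v)"
    using fin by simp
  then obtain x where x: "x \<in> L v" "x \<notin> B"
    using finB by (metis card_mono leD subsetI)
  then have less: "card {w \<in> F. c w = x} < m"
    using c(2) by (auto simp: B_def order_less_le)
  let ?c = "c(v := x)"
  have "card {w \<in> insert v F. ?c w = y} \<le> m" for y
  proof (cases "y = x")
    case True
    then have "{w \<in> insert v F. ?c w = y} = insert v {w \<in> F. c w = x}"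
      using insert.hyps by auto
    then show ?thesis
      using less insert.hyps by simp
  next
    case False
    then have "{w \<in> insert v F. ?c w = y} = {w \<in> F. c w = y}"
      using insert.hyps by auto
    then show ?thesis
      using c(2) by simp
  qed
  moreover have "\<forall>w\<in>insert v F. ?c w \<in> L w"
    using c(1) x by auto
  ultimately show ?case by blast
qed

text \<open>A cycle passes through as many distinct vertices as it has arcs, so inside
  \<open>S\<close> its length is at most 2, and \<open>acyclic_graph\<close> only forbids length 3
  or more.\<close>

lemma (in wf_digraph) acyclic_graph_induce_card_le_2:
  assumes "finite S" and "card S \<le> 2"
  shows "acyclic_graph (G \<restriction> S)"
  unfolding acyclic_graph_def
proof safe
  fix p
  assume cyc: "pre_digraph.cycle (G \<restriction> S) p" and len: "3 \<le> length p"
  interpret H: wf_digraph "G \<restriction> S" by auto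
  from cyc obtain u where u: "H.awalk u p u" "distinct (tl (H.awalk_verts u p))"
    unfolding H.cycle_def by blast
  have "set (H.awalk_verts u p) \<subseteq> S"
    using u(1) by (elim H.awalkE) simp
  then have "set (tl (H.awalk_verts u p)) \<subseteq> S"
    by (cases "H.awalk_verts u p") auto
  then have "card (set (tl (H.awalk_verts u p))) \<le> card S"
    using assms by (intro card_mono)
  \<comment> \<open>A walk lists one vertex more than it has arcs; \<open>tl\<close> drops the start
    vertex, which a closed walk meets again at its end.\<close>
  moreover have "card (set (tl (H.awalk_verts u p))) = length p"
    using u(2) by (simp add: distinct_card H.length_awalk_verts)
  ultimately show False
    using assms len by simp
qed

text \<open>Three vertices of \<open>S\<close> would span a triangle, and going around it once is a
  cycle of length 3 in the induced subgraph.\<close>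

lemma complete_digraph_acyclic_induce_card_le_2:
  assumes "complete_digraph n G" and "S \<subseteq> verts G" and "acyclic_graph (G \<restriction> S)"
  shows "card S \<le> 2"
proof (rule ccontr)
  assume "\<not> card S \<le> 2"
  then have "3 \<le> card S" by simp
  then obtain T where "T \<subseteq> S" "card T = 3"
    by (meson obtain_subset_with_card_n)
  then obtain x y z where xyz: "x \<in> S" "y \<in> S" "z \<in> S" "x \<noteq> y" "y \<noteq> z" "x \<noteq> z"
    by (auto simp: card_3_iff)
  have arc: "\<exists>e\<in>arcs G. tail G e = a \<and> head G e = b" if "a \<in> S" "b \<in> S" "a \<noteq> b" for a b
  proof -
    have "(a, b) \<in> arcs_ends G"
      using that assms(1,2) by (auto simp: complete_digraph_def)
    then show ?thesis
      by (auto simp: arcs_ends_conv)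
  qed
  obtain e where "e \<in> arcs G" "tail G e = x" "head G e = y"
    using arc xyz by blast
  moreover obtain f where "f \<in> arcs G" "tail G f = y" "head G f = z"
    using arc xyz by blast
  moreover obtain g where "g \<in> arcs G" "tail G g = z" "head G g = x"
    using arc xyz by blast
  ultimately have "pre_digraph.cycle (G \<restriction> S) [e, f, g]"
    unfolding pre_digraph.cycle_def pre_digraph.awalk_def using xyz
    by (intro exI[of _ x]) (simp add: pre_digraph.cas.simps pre_digraph.awalk_verts.simps)
  then have "\<exists>p. pre_digraph.cycle (G \<restriction> S) p \<and> 3 \<le> length p"
    by (intro exI[of _ "[e, f, g]"]) simp
  then show False
    using assms(3) unfolding acyclic_graph_def by blast
qed

lemma complete_digraph_equitable_list_point_arborable:
  assumes "complete_digraph n G" and "1 \<le> n" and "n \<le> 2 * k"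
  shows "equitable_list_point_arborable G k"
  unfolding equitable_list_point_arborable_def
proof (intro allI impI)
  fix L
  assume L: "list_assignment G k L"
  interpret graph G
    using assms(1) by (simp add: complete_digraph_def)
  have card: "card (verts G) = n"
    using assms(1) by (simp add: complete_digraph_def)
  have k: "0 < k"
    using assms by simp
  define m where "m = nat \<lceil>real n / real k\<rceil>"
  \<comment> \<open>A ceiling is nonnegative iff its argument exceeds -1, so \<open>nat\<close>
    truncates nothing in \<open>m\<close>.\<close>
  have "- 1 < real n / real k"
    by (rule less_le_trans[of _ 0]) auto
  then have m: "int m = \<lceil>real n / real k\<rceil>"
    by (simp add: m_def)
  have "real n / real k \<le> real m"
    by (simp add: m_def real_nat_ceiling_ge)
  then have "real n \<le> real (m * k)"
    using k by (simp add: field_simps)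
  then have "card (verts G) \<le> m * k"
    unfolding card of_nat_le_iff .
  then obtain c where c: "\<forall>v\<in>verts G. c v \<in> L v" "\<forall>x. card {v \<in> verts G. c v = x} \<le> m"
    using ex_list_coloring_bounded_classes[of "verts G" m k L] L finite_verts
    unfolding list_assignment_def by blast
  \<comment> \<open>With at most two vertices per class, the size bound alone already makes every
    class acyclic.\<close>
  have "real n / real k \<le> 2"
    using k assms(3) by (simp add: divide_le_eq)
  then have "m \<le> 2"
    by (simp add: m_def ceiling_le_iff)
  have class_le: "card (color_class G c x) \<le> m" for x
    using c(2) by (simp add: color_class_def)
  have "acyclic_graph (G \<restriction> color_class G c x)" for x
    using class_le[of x] \<open>m \<le> 2\<close>
    by (intro acyclic_graph_induce_card_le_2) (auto simp: color_class_def)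
  moreover have "int (card (color_class G c x)) \<le> \<lceil>real (card (verts G)) / real k\<rceil>" for x
    using class_le[of x] m card by simp
  ultimately show "\<exists>c. (\<forall>v\<in>verts G. c v \<in> L v) \<and>
      (\<forall>x. acyclic_graph (G \<restriction> color_class G c x)) \<and>
      (\<forall>x. int (card (color_class G c x)) \<le> \<lceil>real (card (verts G)) / real k\<rceil>)"
    using c(1) by blast
qed

lemma complete_digraph_equitable_list_point_arborable_ge:
  assumes "complete_digraph n G" and "equitable_list_point_arborable G k"
  shows "n \<le> 2 * k"
proof -
  \<comment> \<open>Identical lists turn the list coloring into an ordinary one with
    \<open>k\<close> colors, so the vertices split into \<open>k\<close> acyclic classes. For
    \<open>k = 0\<close> this leaves no vertices.\<close>
  have "list_assignment G k (\<lambda>_. {..<k})"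
    by (simp add: list_assignment_def)
  then obtain c where c: "\<forall>v\<in>verts G. c v < k" "\<forall>x. acyclic_graph (G \<restriction> color_class G c x)"
    using assms(2) unfolding equitable_list_point_arborable_def by blast
  have "verts G = (\<Union>x<k. color_class G c x)"
    using c(1) by (auto simp: color_class_def)
  then have "n = card (\<Union>x<k. color_class G c x)"
    using assms(1) by (simp add: complete_digraph_def)
  also have "\<dots> \<le> (\<Sum>x<k. card (color_class G c x))"
    by (rule card_UN_le) simp
  also have "\<dots> \<le> (\<Sum>x<k. 2)"
    using c(2) by (intro sum_mono complete_digraph_acyclic_induce_card_le_2[OF assms(1)])
      (auto simp: color_class_def)
  finally show ?thesis by simp
qed

theorem theorem1:
  fixes G :: "('a, 'b) pre_digraph" and n :: nat
  assumes "n \<ge> 1" and "complete_digraph n G"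
  shows "(\<forall>k::nat. int k \<ge> \<lceil>real n / 2\<rceil> \<longrightarrow> equitable_list_point_arborable G k) \<and>
         int (equitable_list_point_arboricity G) = \<lceil>real n / 2\<rceil>"
proof -
  have iff: "\<lceil>real n / 2\<rceil> \<le> int k \<longleftrightarrow> n \<le> 2 * k" for k
    by linarith
  \<comment> \<open>The admissible \<open>k\<close> form a ray starting at the ceiling, which gives
    both claims. That they are upward closed is not immediate from the definition: larger lists come
    with a smaller cap on the classes.\<close>
  have arb: "equitable_list_point_arborable G k \<longleftrightarrow> \<lceil>real n / 2\<rceil> \<le> int k" for k
    unfolding iff
    using complete_digraph_equitable_list_point_arborable[OF assms(2,1)]
      complete_digraph_equitable_list_point_arborable_ge[OF assms(2)] by blast
  have "0 \<le> \<lceil>real n / 2\<rceil>"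
    by simp
  then have "equitable_list_point_arboricity G = nat \<lceil>real n / 2\<rceil>"
    unfolding equitable_list_point_arboricity_def arb
    by (intro Least_equality) (simp_all only: int_nat_eq if_True order_refl nat_le_iff)
  then show ?thesis
    using arb \<open>0 \<le> \<lceil>real n / 2\<rceil>\<close> by simp
qed

end
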